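(* Let $M_n$ be a free metabelian group of rank $n$ with basis $X=\{x_1,\ldots,x_n\}$. Then $$\mathrm{pw}(M_n,X)\le 4n-1.$$
   Context: Let $G$ be a group with generating set $S$. A (freely) reduced word in the alphabet $S^{\pm1}$ is a palindrome if it reads the same left-to-right and right-to-left; an element of $G$ is a palindrome (with respect to $S$) if it is represented by some palindromic word in $S^{\pm1}$. The palindromic length $l_{\mathcal P}(g)$ of $g\in G$ is the minimal $k$ such that $g$ is a product of $k$ palindromes, and the palindromic width is $\mathrm{pw}(G,S)=\sup_{g\in G} l_{\mathcal P}(g)$. The free metabelian group of rank $n$ is $M_n=F_n/F_n''$, where $F_n$ is the free group of rank $n$ and $F_n''$ its second derived subgroup; its basis $X$ is the image of a free basis of $F_n$. *)

theory Defs
  imports "HOL-Algebra.Algebra" "HOL-Library.Extended_Nat"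
begin

text \<open>A letter \<open>(x, True)\<close> stands for \<open>x\<close> and \<open>(x, False)\<close> for its formal inverse.\<close>

type_synonym 'a letter = "'a \<times> bool"

definition letter_inv :: "'a letter \<Rightarrow> 'a letter" where
  "letter_inv l = (fst l, \<not> snd l)"

definition reduced :: "'a letter list \<Rightarrow> bool" where
  "reduced w \<longleftrightarrow> successively (\<lambda>l m. m \<noteq> letter_inv l) w"

definition reduced_words :: "'a set \<Rightarrow> 'a letter list set" where
  "reduced_words A = {w \<in> lists (A \<times> UNIV). reduced w}"

text \<open>For reduced \<open>w\<close>, \<open>cancel_Cons l w\<close> is the reduced form of \<open>l # w\<close>; hence, for
  reduced \<open>u\<close> and \<open>v\<close>, \<open>foldr cancel_Cons u v\<close> is the reduced form of \<open>u @ v\<close>.\<close>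

fun cancel_Cons :: "'a letter \<Rightarrow> 'a letter list \<Rightarrow> 'a letter list" where
  "cancel_Cons l [] = [l]"
| "cancel_Cons l (m # w) = (if m = letter_inv l then w else l # m # w)"

definition free_group :: "'a set \<Rightarrow> 'a letter list monoid" where
  "free_group A = \<lparr>carrier = reduced_words A, monoid.mult = foldr cancel_Cons, one = []\<rparr>"

definition letter_value :: "('g, 'm) monoid_scheme \<Rightarrow> 'g letter \<Rightarrow> 'g" where
  "letter_value G l = (if snd l then fst l else inv\<^bsub>G\<^esub> (fst l))"

definition word_value :: "('g, 'm) monoid_scheme \<Rightarrow> 'g letter list \<Rightarrow> 'g" where
  "word_value G w = foldr (\<lambda>l g. letter_value G l \<otimes>\<^bsub>G\<^esub> g) w \<one>\<^bsub>G\<^esub>"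

text \<open>\<open>B\<close> is a free basis of \<open>F\<close> if the homomorphism from the free group on \<open>B\<close> extending the
  inclusion of \<open>B\<close> into \<open>F\<close> is an isomorphism.\<close>

definition free_basis :: "('g, 'm) monoid_scheme \<Rightarrow> 'g set \<Rightarrow> bool" where
  "free_basis F B \<longleftrightarrow> B \<subseteq> carrier F \<and> word_value F \<in> iso (free_group B) F"

definition second_derived :: "('g, 'm) monoid_scheme \<Rightarrow> 'g set" where
  "second_derived F = derived F (derived F (carrier F))"

definition max_metabelian_quotient :: "('g, 'm) monoid_scheme \<Rightarrow> 'g set monoid" where
  "max_metabelian_quotient F = F Mod second_derived F"

definition basis_image :: "('g, 'm) monoid_scheme \<Rightarrow> 'g set \<Rightarrow> 'g set set" where
  "basis_image F B = (\<lambda>b. second_derived F #>\<^bsub>F\<^esub> b) ` B"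

definition palindromes :: "('g, 'm) monoid_scheme \<Rightarrow> 'g set \<Rightarrow> 'g set" where
  "palindromes G S = word_value G ` {w \<in> reduced_words S. rev w = w}"

text \<open>The length is \<open>\<infinity>\<close> for elements that are not products of palindromes, and the width is \<open>\<infinity>\<close>
  if the lengths are unbounded. The identity is the empty product, of length \<open>0\<close>.\<close>

definition palindromic_length :: "('g, 'm) monoid_scheme \<Rightarrow> 'g set \<Rightarrow> 'g \<Rightarrow> enat" where
  "palindromic_length G S g =
     Inf {enat (length ps) | ps. ps \<in> lists (palindromes G S) \<and> foldr (\<otimes>\<^bsub>G\<^esub>) ps \<one>\<^bsub>G\<^esub> = g}"

definition palindromic_width :: "('g, 'm) monoid_scheme \<Rightarrow> 'g set \<Rightarrow> enat" where
  "palindromic_width G S = (SUP g\<in>carrier G. palindromic_length G S g)"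


lemma letter_inv_simps [simp]:
  "letter_inv (letter_inv l) = l" "letter_inv l \<noteq> l" "fst (letter_inv l) = fst l"
  by (auto simp: letter_inv_def prod_eq_iff)

lemma reduced_Nil [simp]: "reduced []"
  by (simp add: reduced_def)

lemma reduced_Cons: "reduced (l # w) \<longleftrightarrow> reduced w \<and> (w = [] \<or> hd w \<noteq> letter_inv l)"
  by (auto simp: reduced_def successively_Cons)

lemma cancel_Cons_reduced: "reduced (l # w) \<Longrightarrow> cancel_Cons l w = l # w"
  by (cases w) (auto simp: reduced_Cons)

lemma reduced_cancel_Cons: "reduced w \<Longrightarrow> reduced (cancel_Cons l w)"
  by (cases w) (auto simp: reduced_Cons)

lemma reduced_foldr_cancel_Cons: "reduced v \<Longrightarrow> reduced (foldr cancel_Cons u v)"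
  by (induction u) (auto simp: reduced_cancel_Cons)

lemma cancel_Cons_letter_inv:
  assumes "reduced w" shows "cancel_Cons l (cancel_Cons (letter_inv l) w) = w"
proof (cases w)
  case (Cons m v)
  then show ?thesis using assms by (cases v) (auto simp: reduced_Cons)
qed auto

lemma foldr_cancel_Cons_reduced: "reduced u \<Longrightarrow> foldr cancel_Cons u [] = u"
  by (induction u) (auto simp: reduced_Cons cancel_Cons_reduced)

lemma foldr_cancel_Cons:
  assumes "reduced w"
  shows "foldr cancel_Cons (cancel_Cons l v) w = cancel_Cons l (foldr cancel_Cons v w)"
  using assms cancel_Cons_letter_inv[of "foldr cancel_Cons (tl v) w" l]
  by (cases v) (auto simp: reduced_foldr_cancel_Cons)

lemma foldr_cancel_Cons_assoc:
  assumes "reduced w"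
  shows "foldr cancel_Cons (foldr cancel_Cons u v) w = foldr cancel_Cons u (foldr cancel_Cons v w)"
  by (induction u) (auto simp: foldr_cancel_Cons assms)

lemma set_cancel_Cons: "set (cancel_Cons l w) \<subseteq> insert l (set w)"
  by (cases w) auto

lemma set_foldr_cancel_Cons: "set (foldr cancel_Cons u v) \<subseteq> set u \<union> set v"
proof (induction u)
  case (Cons l u)
  then show ?case using set_cancel_Cons[of l "foldr cancel_Cons u v"] by auto
qed simp

lemma foldr_cancel_Cons_inverse:
  "reduced v \<Longrightarrow> foldr cancel_Cons (rev (map letter_inv u)) (foldr cancel_Cons u v) = v"
proof (induction u)
  case (Cons l u)
  then show ?case
    using cancel_Cons_letter_inv[of "foldr cancel_Cons u v" "letter_inv l"]
    by (simp add: reduced_foldr_cancel_Cons)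
qed simp

lemma reduced_inverse: "reduced u \<Longrightarrow> reduced (rev (map letter_inv u))"
  unfolding reduced_def successively_rev successively_map
  by (erule successively_mono) (metis letter_inv_simps(1))

theorem group_free_group: "group (free_group A)"
proof (rule groupI)
  show "\<exists>y\<in>carrier (free_group A). y \<otimes>\<^bsub>free_group A\<^esub> x = \<one>\<^bsub>free_group A\<^esub>"
    if "x \<in> carrier (free_group A)" for x
  proof
    have x: "reduced x" "set x \<subseteq> A \<times> UNIV"
      using that by (auto simp: free_group_def reduced_words_def)
    show "rev (map letter_inv x) \<otimes>\<^bsub>free_group A\<^esub> x = \<one>\<^bsub>free_group A\<^esub>"
      using foldr_cancel_Cons_inverse[of "[]" x] x(1)
      by (simp add: free_group_def foldr_cancel_Cons_reduced)
    show "rev (map letter_inv x) \<in> carrier (free_group A)"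
      using x reduced_inverse[of x]
      by (fastforce simp: free_group_def reduced_words_def letter_inv_def)
  qed
qed (use set_foldr_cancel_Cons in \<open>fastforce simp: free_group_def reduced_words_def
       reduced_foldr_cancel_Cons foldr_cancel_Cons_assoc\<close>)+

lemma letter_inv_eval_free_group:
  assumes "a \<in> A"
  shows "inv\<^bsub>free_group A\<^esub> [(a, True)] = [(a, False)]"
proof (rule group.inv_equality[OF group_free_group])
qed (use assms in \<open>auto simp: free_group_def reduced_words_def reduced_Cons letter_inv_def\<close>)

theorem free_basis_free_group: "free_basis (free_group A) ((\<lambda>a. [(a, True)]) ` A)"
proof -
  let ?F = "free_group A" and ?B = "(\<lambda>a. [(a, True)]) ` A"
  define h :: "'a letter list letter \<Rightarrow> 'a letter" where "h = (\<lambda>l. (fst (hd (fst l)), snd l))"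
  define k :: "'a letter \<Rightarrow> 'a letter list letter" where "k = (\<lambda>l. ([(fst l, True)], snd l))"
  interpret group ?F by (rule group_free_group)
  have hk: "h (k l) = l" for l by (simp add: h_def k_def)
  have kh: "k (h l) = l" if "l \<in> ?B \<times> UNIV" for l using that by (auto simp: h_def k_def)
  have h_in: "map h w \<in> lists (A \<times> UNIV)" if "w \<in> lists (?B \<times> UNIV)" for w
    using that by (induction w) (auto simp: h_def)
  have h_inv: "h m = letter_inv (h l) \<longleftrightarrow> m = letter_inv l"
    if "l \<in> ?B \<times> UNIV" "m \<in> ?B \<times> UNIV" for l m
    using that by (auto simp: h_def letter_inv_def)
  have red_h: "reduced (map h w) \<longleftrightarrow> reduced w" if "w \<in> lists (?B \<times> UNIV)" for w
    using that
  proof (induction w)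
    case (Cons l w)
    then show ?case using h_inv[of l "hd w"] by (cases w) (auto simp: reduced_Cons)
  qed auto
  have cancel_h: "map h (cancel_Cons l w) = cancel_Cons (h l) (map h w)"
    if "l \<in> ?B \<times> UNIV" "w \<in> lists (?B \<times> UNIV)" for l w
    using that h_inv[of l "hd w"] by (cases w) auto
  have mult_h: "map h (foldr cancel_Cons u v) = foldr cancel_Cons (map h u) (map h v)"
    if "u \<in> lists (?B \<times> UNIV)" "v \<in> lists (?B \<times> UNIV)" for u v
    using that(1)
  proof (induction u)
    case (Cons l u)
    have "foldr cancel_Cons u v \<in> lists (?B \<times> UNIV)"
      using set_foldr_cancel_Cons[of u v] Cons.hyps that(2) by (auto simp: lists_eq_set)
    then show ?case using Cons cancel_h[of l "foldr cancel_Cons u v"] by simp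
  qed simp
  have letter: "letter_value ?F l = [h l]" if "l \<in> ?B \<times> UNIV" for l
    using that letter_inv_eval_free_group[of _ A] by (auto simp: letter_value_def h_def)
  have val: "word_value ?F w = map h w" if "w \<in> reduced_words ?B" for w
    using that
  proof (induction w)
    case Nil
    then show ?case by (simp add: word_value_def free_group_def)
  next
    case (Cons l w)
    then have l: "l \<in> ?B \<times> UNIV" and w: "w \<in> reduced_words ?B" "l # w \<in> lists (?B \<times> UNIV)"
      "reduced (l # w)"
      by (auto simp: reduced_words_def reduced_Cons)
    have "word_value ?F (l # w) = [h l] \<otimes>\<^bsub>?F\<^esub> map h w"
      using Cons.IH[OF w(1)] by (simp add: word_value_def letter[OF l])
    also have "\<dots> = cancel_Cons (h l) (map h w)" by (simp add: free_group_def)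
    also have "\<dots> = map h (l # w)"
      using red_h[OF w(2)] w(3) by (simp add: cancel_Cons_reduced)
    finally show ?case .
  qed
  have "word_value ?F \<in> hom (free_group ?B) ?F"
  proof (rule homI)
    fix u v assume uv: "u \<in> carrier (free_group ?B)" "v \<in> carrier (free_group ?B)"
    then have uv': "u \<in> reduced_words ?B" "v \<in> reduced_words ?B" by (auto simp: free_group_def)
    show "word_value ?F u \<in> carrier ?F"
      unfolding val[OF uv'(1)] using uv'(1) red_h[of u] h_in[of u]
      by (simp add: free_group_def reduced_words_def)
    have m: "foldr cancel_Cons u v \<in> reduced_words ?B"
      using monoid.m_closed[OF group.is_monoid[OF group_free_group] uv] by (simp add: free_group_def)
    show "word_value ?F (u \<otimes>\<^bsub>free_group ?B\<^esub> v) = word_value ?F u \<otimes>\<^bsub>?F\<^esub> word_value ?F v"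
      using val[OF m] val[OF uv'(1)] val[OF uv'(2)] mult_h[of u v] uv'
      by (simp add: free_group_def reduced_words_def)
  qed
  moreover have "bij_betw (word_value ?F) (reduced_words ?B) (reduced_words A)"
  proof (rule bij_betw_byWitness[where f' = "map k"])
    have kk: "map k (map h w) = w" if "w \<in> reduced_words ?B" for w
      using that kh by (auto simp: reduced_words_def intro!: map_idI)
    have k_in: "map k w \<in> reduced_words ?B" if "w \<in> reduced_words A" for w
    proof -
      have 1: "map k w \<in> lists (?B \<times> UNIV)"
        using that by (fastforce simp: reduced_words_def k_def)
      have "map h (map k w) = w" by (simp add: hk map_idI)
      then show ?thesis using red_h[OF 1] that 1 by (simp add: reduced_words_def)
    qed
    show "\<forall>w\<in>reduced_words ?B. map k (word_value ?F w) = w" using val kk by simp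
    show "\<forall>w\<in>reduced_words A. word_value ?F (map k w) = w" using val k_in by (simp add: hk map_idI)
    have "map h w \<in> reduced_words A" if "w \<in> reduced_words ?B" for w
      using that red_h[of w] h_in[of w] by (simp add: reduced_words_def)
    then show "word_value ?F ` reduced_words ?B \<subseteq> reduced_words A"
      using val by auto
    show "map k ` reduced_words A \<subseteq> reduced_words ?B" using k_in by auto
  qed
  moreover have "?B \<subseteq> carrier ?F"
    by (auto simp: free_group_def reduced_words_def reduced_Cons)
  ultimately show ?thesis by (simp add: free_basis_def iso_def free_group_def)
qed

end

theory Submission
  imports Defs
begin

text \<open>The bound holds for every metabelian group \<open>G\<close> generated by a finite nonempty set
  \<open>{x\<^sub>1, \<dots>, x\<^sub>n}\<close> (\<open>palindromic_width_le\<close>), and the free metabelian group is generated by the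
  images of a free basis. Write \<open>comm g h\<close> for \<open>g h g\<^sup>-\<^sup>1 h\<^sup>-\<^sup>1\<close> and \<open>D\<close> for the derived subgroup
  of \<open>G\<close>.

  Modulo \<open>D\<close> the group is abelian, so each element of \<open>G\<close> is \<open>d x\<^sub>1\<^bsup>k1\<^esup> \<dots> x\<^sub>n\<^bsup>kn\<^esup>\<close> with
  \<open>d \<in> D\<close> (\<open>D_mult_power_products\<close>). The main point is that \<open>d\<close> is a product of only \<open>n\<close>
  commutators, one \<open>comm g\<^sub>i x\<^sub>i\<close> for each generator (\<open>D_subset_comm_products\<close>). View \<open>D\<close> as a
  module on which \<open>G\<close> acts by conjugation. The products \<open>\<Prod> comm a\<^sub>i x\<^sub>i\<close> with \<open>a\<^sub>i \<in> D\<close> run through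
  the sums of the \<open>(1 - x\<^sub>i) a\<^sub>i\<close>, that is, through all of the commutator subgroup of \<open>D\<close> and \<open>G\<close>.
  Modulo that subgroup, \<open>D\<close> is central and commutators are bilinear, so there every commutator,
  and then every element of \<open>D\<close>, is a product of commutators \<open>comm g\<^sub>i x\<^sub>i\<close>. The two levels fit
  together because \<open>comm (a g) x = comm g x comm a x\<close> for \<open>a \<in> D\<close>.

  If \<open>r\<close> is obtained by reading a word for \<open>g\<close> backwards, then
  \<open>comm g x = (g x r) (r\<^sup>-\<^sup>1 g\<^sup>-\<^sup>1) x\<^sup>-\<^sup>1\<close> is a product of three palindromes. Powers of generators are
  palindromes as well, which gives \<open>3 n + n\<close> factors. Since \<open>D\<close> is commutative, the
  commutator with \<open>x\<^sub>1\<close> can be placed last, directly before the power of \<open>x\<^sub>1\<close>; the trailing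
  \<open>x\<^sub>1\<^sup>-\<^sup>1\<close> merges with that power, and one factor is saved.\<close>

section \<open>Palindromes in a group\<close>

context group
begin

abbreviation comm :: "'a \<Rightarrow> 'a \<Rightarrow> 'a" where
  "comm g h \<equiv> g \<otimes> h \<otimes> inv g \<otimes> inv h"

abbreviation D :: "'a set" where
  "D \<equiv> derived G (carrier G)"

lemma inv_mult_cancel [simp]:
  assumes "x \<in> carrier G" "y \<in> carrier G"
  shows "x \<otimes> (inv x \<otimes> y) = y" "inv x \<otimes> (x \<otimes> y) = y"
  using assms by (simp_all add: m_assoc [symmetric])

lemma letter_value_closed [simp]:
  "S \<subseteq> carrier G \<Longrightarrow> l \<in> S \<times> UNIV \<Longrightarrow> letter_value G l \<in> carrier G"
  by (auto simp: letter_value_def)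

lemma letter_value_letter_inv:
  "S \<subseteq> carrier G \<Longrightarrow> l \<in> S \<times> UNIV \<Longrightarrow> letter_value G (letter_inv l) = inv (letter_value G l)"
  by (auto simp: letter_value_def letter_inv_def)

lemma word_value_simps [simp]:
  "word_value G [] = \<one>"
  "word_value G (l # w) = letter_value G l \<otimes> word_value G w"
  by (simp_all add: word_value_def)

lemma word_value_closed [simp]:
  assumes "S \<subseteq> carrier G" "w \<in> lists (S \<times> UNIV)"
  shows "word_value G w \<in> carrier G"
  using assms(2) letter_value_closed[OF assms(1)] by induction auto

lemma word_value_append:
  assumes S: "S \<subseteq> carrier G" and u: "u \<in> lists (S \<times> UNIV)" and v: "v \<in> lists (S \<times> UNIV)"
  shows "word_value G (u @ v) = word_value G u \<otimes> word_value G v"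
  using u
proof induction
  case Nil
  then show ?case using word_value_closed[OF S v] by simp
next
  case (Cons l u)
  then show ?case
    using word_value_closed[OF S v] word_value_closed[OF S, of u] letter_value_closed[OF S, of l]
    by (simp add: m_assoc)
qed

lemma word_value_in_generate:
  assumes "w \<in> lists (S \<times> UNIV)"
  shows "word_value G w \<in> generate G S"
  using assms
proof induction
  case Nil
  then show ?case by (simp add: generate.one)
next
  case (Cons l w)
  have "letter_value G l \<in> generate G S"
    using Cons.hyps(1) by (auto simp: letter_value_def intro: generate.incl generate.inv)
  then show ?case using Cons.IH by (simp add: generate.eng)
qed

lemma palindromes_closed: "S \<subseteq> carrier G \<Longrightarrow> palindromes G S \<subseteq> carrier G"
  unfolding palindromes_def reduced_words_def by (auto intro!: word_value_closed)

lemma one_in_palindromes: "\<one> \<in> palindromes G S"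
  unfolding palindromes_def reduced_words_def by (rule image_eqI[of _ _ "[]"]) auto

lemma letter_in_palindromes:
  assumes S: "S \<subseteq> carrier G" and l: "l \<in> S \<times> UNIV"
  shows "letter_value G l \<in> palindromes G S"
  unfolding palindromes_def reduced_words_def
  using l letter_value_closed[OF S l]
  by (intro image_eqI[of _ _ "[l]"]) (auto simp: reduced_Cons)

text \<open>Palindromes are values of reduced words only, and the word \<open>l # w @ [l]\<close> need not be
  reduced. By symmetry, though, cancellation at its left end is matched by cancellation at its
  right end, and what remains is again a palindrome.\<close>

lemma palindromes_sandwich:
  assumes S: "S \<subseteq> carrier G" and l: "l \<in> S \<times> UNIV" and p: "p \<in> palindromes G S"
  shows "letter_value G l \<otimes> p \<otimes> letter_value G l \<in> palindromes G S"
proof -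
  let ?x = "letter_value G l"
  have x: "?x \<in> carrier G" using letter_value_closed[OF S l] .
  obtain w where w: "w \<in> lists (S \<times> UNIV)" "reduced w" "rev w = w" and p_eq: "p = word_value G w"
    using p by (auto simp: palindromes_def reduced_words_def)
  have pal: "word_value G v \<in> palindromes G S"
    if "v \<in> lists (S \<times> UNIV)" "reduced v" "rev v = v" for v
    using that unfolding palindromes_def reduced_words_def by blast
  have lv: "[l] \<in> lists (S \<times> UNIV)" using l by auto
  show ?thesis
  proof (cases "w = [] \<or> hd w \<noteq> letter_inv l")
    case True
    have ll: "l \<noteq> letter_inv l" using letter_inv_simps(2) by (rule not_sym)
    have "reduced (l # w @ [l])"
    proof (cases "w = []")
      case True
      then show ?thesis using ll by (simp add: reduced_Cons)
    next
      case False
      have "last w = hd w" using hd_rev[of w] w(3) by simp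
      moreover have "l \<noteq> letter_inv (hd w)"
      proof
        assume "l = letter_inv (hd w)"
        then have "letter_inv l = hd w" by simp
        then show False using True False by simp
      qed
      ultimately have "l \<noteq> letter_inv (last w)" by simp
      then have "reduced (w @ [l])"
        using w(2) by (simp add: reduced_def successively_append_iff)
      then show ?thesis using True False by (simp add: reduced_Cons)
    qed
    then have "word_value G (l # w @ [l]) \<in> palindromes G S"
      using w l by (intro pal) auto
    moreover have "word_value G (l # w @ [l]) = ?x \<otimes> p \<otimes> ?x"
      using word_value_append[OF S w(1) lv] word_value_closed[OF S w(1)] x
      by (simp add: p_eq m_assoc)
    ultimately show ?thesis by simp
  next
    case False
    then obtain v where v: "w = letter_inv l # v" by (cases w) auto
    have xi: "letter_value G (letter_inv l) = inv ?x" by (rule letter_value_letter_inv[OF S l])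
    show ?thesis
    proof (cases v rule: rev_cases)
      case Nil
      then show ?thesis using letter_in_palindromes[OF S l] x by (simp add: p_eq v xi)
    next
      case (snoc u m)
      have "m # (rev u @ [letter_inv l]) = letter_inv l # (u @ [m])"
        using w(3)[unfolded v snoc rev.simps rev_append append.simps append_assoc] .
      then have m: "m = letter_inv l" and u: "rev u = u"
        by (metis list.inject, metis list.inject append1_eq_conv)
      have uS: "u \<in> lists (S \<times> UNIV)" and mS: "[m] \<in> lists (S \<times> UNIV)"
        using w(1) by (auto simp: v snoc)
      have "reduced u" using w(2)
        by (auto simp: v snoc reduced_def successively_Cons successively_append_iff)
      then have "word_value G u \<in> palindromes G S" using uS u by (intro pal)
      moreover have "?x \<otimes> p \<otimes> ?x = word_value G u"
        using word_value_append[OF S uS mS] word_value_closed[OF S uS] x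
        by (simp add: p_eq v snoc m xi m_assoc)
      ultimately show ?thesis by simp
    qed
  qed
qed

lemma letter_value_pow_in_palindromes:
  assumes S: "S \<subseteq> carrier G" and l: "l \<in> S \<times> UNIV"
  shows "letter_value G l [^] (m::nat) \<in> palindromes G S"
proof (induction m rule: induct_nat_012)
  case 0
  then show ?case by (simp add: one_in_palindromes)
next
  case 1
  then show ?case using letter_in_palindromes[OF S l] letter_value_closed[OF S l] by simp
next
  case (ge2 m)
  have "letter_value G l [^] Suc (Suc m)
      = letter_value G l \<otimes> letter_value G l [^] m \<otimes> letter_value G l"
    using letter_value_closed[OF S l] by (metis nat_pow_Suc nat_pow_Suc2)
  then show ?case using palindromes_sandwich[OF S l ge2.IH(1)] by simp
qed

lemma int_pow_in_palindromes:
  assumes S: "S \<subseteq> carrier G" and x: "x \<in> S"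
  shows "x [^] (k::int) \<in> palindromes G S"
proof (cases k rule: int_cases2)
  case (nonneg m)
  then show ?thesis
    using letter_value_pow_in_palindromes[OF S, of "(x, True)" m] x
    by (simp add: letter_value_def int_pow_int)
next
  case (nonpos m)
  have "x \<in> carrier G" using S x by auto
  then show ?thesis
    using letter_value_pow_in_palindromes[OF S, of "(x, False)" m] x nonpos
    by (simp add: letter_value_def int_pow_neg_int nat_pow_inv)
qed

text \<open>The element \<open>r\<close> is the value of a word for \<open>g\<close> read backwards, and \<open>inv r\<close> is then the value
  of that word with every letter inverted, whose reversal has value \<open>inv g\<close>.\<close>

lemma reversal_exists:
  assumes S: "S \<subseteq> carrier G" and g: "g \<in> generate G S"
  shows "\<exists>r\<in>carrier G. \<forall>p\<in>palindromes G S.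
    g \<otimes> p \<otimes> r \<in> palindromes G S \<and> inv r \<otimes> p \<otimes> inv g \<in> palindromes G S"
  using g
proof induction
  case one
  then show ?case using palindromes_closed[OF S] by (intro bexI[of _ \<one>]) auto
next
  case (incl x)
  then show ?case
    using S palindromes_sandwich[OF S, of "(x, True)"] palindromes_sandwich[OF S, of "(x, False)"]
    by (intro bexI[of _ x]) (auto simp: letter_value_def)
next
  case (inv x)
  then have "x \<in> carrier G" using S by auto
  then show ?case
    using inv palindromes_sandwich[OF S, of "(x, True)"] palindromes_sandwich[OF S, of "(x, False)"]
    by (intro bexI[of _ "inv x"]) (auto simp: letter_value_def)
next
  case (eng g1 g2)
  obtain r1 r2 where r: "r1 \<in> carrier G" "r2 \<in> carrier G"
    and r1: "\<And>p. p \<in> palindromes G S \<Longrightarrow>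
      g1 \<otimes> p \<otimes> r1 \<in> palindromes G S \<and> inv r1 \<otimes> p \<otimes> inv g1 \<in> palindromes G S"
    and r2: "\<And>p. p \<in> palindromes G S \<Longrightarrow>
      g2 \<otimes> p \<otimes> r2 \<in> palindromes G S \<and> inv r2 \<otimes> p \<otimes> inv g2 \<in> palindromes G S"
    using eng.IH by blast
  have g: "g1 \<in> carrier G" "g2 \<in> carrier G" using eng.hyps generate_in_carrier[OF S] by auto
  have "g1 \<otimes> g2 \<otimes> p \<otimes> (r2 \<otimes> r1) \<in> palindromes G S \<and>
      inv (r2 \<otimes> r1) \<otimes> p \<otimes> inv (g1 \<otimes> g2) \<in> palindromes G S"
    if p: "p \<in> palindromes G S" for p
  proof -
    have pc: "p \<in> carrier G" using p palindromes_closed[OF S] by auto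
    have "g1 \<otimes> (g2 \<otimes> p \<otimes> r2) \<otimes> r1 \<in> palindromes G S"
      "inv r1 \<otimes> (inv r2 \<otimes> p \<otimes> inv g2) \<otimes> inv g1 \<in> palindromes G S"
      using r1 r2 p by auto
    then show ?thesis using g r pc by (simp add: m_assoc inv_mult_group)
  qed
  then show ?case using r by (intro bexI[of _ "r2 \<otimes> r1"]) auto
qed

text \<open>The number of factors is exact rather than an upper bound, so that lengths add up; nothing is
  lost, because the identity is itself a palindrome.\<close>

definition palindrome_products :: "'a set \<Rightarrow> nat \<Rightarrow> 'a set" where
  "palindrome_products S k = {foldr (\<otimes>) ps \<one> | ps. ps \<in> lists (palindromes G S) \<and> length ps = k}"

lemma palindrome_products_0: "\<one> \<in> palindrome_products S 0"
  by (auto simp: palindrome_products_def)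

lemma palindrome_products_single:
  assumes "S \<subseteq> carrier G" "p \<in> palindromes G S"
  shows "p \<in> palindrome_products S 1"
  unfolding palindrome_products_def using assms palindromes_closed[OF assms(1)]
  by (auto intro!: exI[of _ "[p]"])

lemma palindrome_products_mult:
  assumes S: "S \<subseteq> carrier G"
    and "a \<in> palindrome_products S j" "b \<in> palindrome_products S k"
  shows "a \<otimes> b \<in> palindrome_products S (j + k)"
proof -
  obtain ps qs where ps: "ps \<in> lists (palindromes G S)" "length ps = j" "a = foldr (\<otimes>) ps \<one>"
    and qs: "qs \<in> lists (palindromes G S)" "length qs = k" "b = foldr (\<otimes>) qs \<one>"
    using assms(2,3) by (auto simp: palindrome_products_def)
  have closed: "foldr (\<otimes>) rs \<one> \<in> carrier G" if "rs \<in> lists (palindromes G S)" for rs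
    using that by induction (use palindromes_closed[OF S] in auto)
  have "foldr (\<otimes>) (ps @ qs) \<one> = foldr (\<otimes>) ps \<one> \<otimes> foldr (\<otimes>) qs \<one>"
    using ps(1)
  proof induction
    case Nil
    then show ?case using closed[OF qs(1)] by simp
  next
    case (Cons p ps)
    then have "p \<in> carrier G" "foldr (\<otimes>) ps \<one> \<in> carrier G"
      using palindromes_closed[OF S] closed by auto
    then show ?case using Cons.IH closed[OF qs(1)] by (simp add: m_assoc)
  qed
  then show ?thesis
    unfolding palindrome_products_def using ps qs by (auto intro!: exI[of _ "ps @ qs"])
qed

text \<open>With \<open>r\<close> the reversal of \<open>g\<close>, the three palindromes are the ones in
  \<open>comm g x \<otimes> x [^] k = (g \<otimes> x \<otimes> r) \<otimes> (inv r \<otimes> inv g) \<otimes> x [^] (k - 1)\<close>: the power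
  absorbs the trailing \<open>inv x\<close> of the commutator.\<close>

lemma comm_mult_pow_palindrome_products:
  assumes S: "S \<subseteq> carrier G" and g: "g \<in> generate G S" and x: "x \<in> S"
  shows "comm g x \<otimes> x [^] (k::int) \<in> palindrome_products S 3"
proof -
  obtain r where r: "r \<in> carrier G"
    and rp: "\<And>p. p \<in> palindromes G S \<Longrightarrow>
      g \<otimes> p \<otimes> r \<in> palindromes G S \<and> inv r \<otimes> p \<otimes> inv g \<in> palindromes G S"
    using reversal_exists[OF S g] by blast
  have gx: "g \<in> carrier G" "x \<in> carrier G" using generate_in_carrier[OF S g] S x by auto
  have xk: "x [^] k = x \<otimes> x [^] (k - 1)"
    using int_pow_mult[OF gx(2), of 1 "k - 1"] gx by simp
  have "x \<in> palindromes G S" using int_pow_in_palindromes[OF S x, of 1] gx by simp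
  then have 1: "g \<otimes> x \<otimes> r \<in> palindrome_products S 1"
    using rp by (intro palindrome_products_single[OF S]) auto
  have 2: "inv r \<otimes> \<one> \<otimes> inv g \<in> palindrome_products S 1"
    using rp one_in_palindromes by (intro palindrome_products_single[OF S]) auto
  have 3: "x [^] (k - 1) \<in> palindrome_products S 1"
    by (intro palindrome_products_single[OF S] int_pow_in_palindromes[OF S x])
  have "(g \<otimes> x \<otimes> r) \<otimes> (inv r \<otimes> \<one> \<otimes> inv g) \<otimes> x [^] (k - 1)
      \<in> palindrome_products S (1 + 1 + 1)"
    by (intro palindrome_products_mult[OF S] 1 2 3)
  moreover have "(g \<otimes> x \<otimes> r) \<otimes> (inv r \<otimes> \<one> \<otimes> inv g) \<otimes> x [^] (k - 1) = comm g x \<otimes> x [^] k"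
    using gx r by (simp add: xk m_assoc)
  ultimately show ?thesis by (simp add: numeral_3_eq_3)
qed

lemma comm_palindrome_products:
  assumes "S \<subseteq> carrier G" "g \<in> generate G S" "x \<in> S"
  shows "comm g x \<in> palindrome_products S 3"
proof -
  have "comm g x \<in> carrier G" using assms generate_in_carrier[OF assms(1,2)] by auto
  then show ?thesis using comm_mult_pow_palindrome_products[OF assms, of 0] by simp
qed

section \<open>Normal form modulo the derived subgroup\<close>

lemma D_subset: "d \<in> D \<Longrightarrow> d \<in> carrier G"
  using derived_in_carrier[of "carrier G"] by auto

lemma comm_in_D: "g \<in> carrier G \<Longrightarrow> h \<in> carrier G \<Longrightarrow> comm g h \<in> D"
  unfolding derived_def by (intro generate.incl) auto

lemma D_subgroup: "subgroup D G"
  by (simp add: derived_is_subgroup)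

lemmas D_mult = subgroup.m_closed[OF D_subgroup]
  and D_inv = subgroup.m_inv_closed[OF D_subgroup]
  and D_one = subgroup.one_closed[OF D_subgroup]
  and D_conj = normal.inv_op_closed2[OF derived_self_is_normal]

fun power_products :: "'a list \<Rightarrow> 'a set" where
  "power_products [] = {\<one>}"
| "power_products (x # xs) = {x [^] (k::int) \<otimes> e | k e. e \<in> power_products xs}"

lemma power_products_closed:
  "set xs \<subseteq> carrier G \<Longrightarrow> power_products xs \<subseteq> carrier G"
  by (induction xs) auto

lemma one_in_power_products: "\<one> \<in> power_products xs"
proof (induction xs)
  case (Cons x xs)
  then have "x [^] (0::int) \<otimes> \<one> \<in> power_products (x # xs)"
    unfolding power_products.simps by (intro CollectI exI[of _ 0] exI[of _ \<one>] conjI refl)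
  then show ?case by simp
qed simp

text \<open>Moving a power of \<open>x\<close> to its place in the ordered product costs commutators with the powers
  it passes, and these collect in \<open>D\<close> on the left because \<open>D\<close> is normal.\<close>

lemma power_products_absorb:
  assumes "set xs \<subseteq> carrier G" "x \<in> set xs" "e \<in> power_products xs"
  shows "\<exists>d\<in>D. \<exists>e'\<in>power_products xs. x [^] (k::int) \<otimes> e = d \<otimes> e'"
  using assms
proof (induction xs arbitrary: e)
  case (Cons y xs)
  obtain j :: int and f where e: "e = y [^] j \<otimes> f" and f: "f \<in> power_products xs"
    using Cons.prems(3) by auto
  have c: "x \<in> carrier G" "y \<in> carrier G" "f \<in> carrier G"
    using Cons.prems f power_products_closed[of xs] by auto
  show ?case
  proof (cases "x = y")
    case True
    have "x [^] k \<otimes> e = \<one> \<otimes> (y [^] (k + j) \<otimes> f)"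
      using c by (simp add: e True int_pow_mult m_assoc)
    then show ?thesis using f D_one by auto
  next
    case False
    then obtain d f' where d: "d \<in> D" and f': "f' \<in> power_products xs"
      and eq: "x [^] k \<otimes> f = d \<otimes> f'"
      using Cons.IH[OF _ _ f] Cons.prems by auto
    have c': "f' \<in> carrier G" "d \<in> carrier G"
      using Cons.prems f' power_products_closed[of xs] D_subset[OF d] by auto
    let ?d = "comm (x [^] k) (y [^] j) \<otimes> (y [^] j \<otimes> d \<otimes> inv (y [^] j))"
    have "x [^] k \<otimes> e = comm (x [^] k) (y [^] j) \<otimes> (y [^] j \<otimes> (x [^] k \<otimes> f))"
      using c by (simp add: e m_assoc)
    also have "\<dots> = ?d \<otimes> (y [^] j \<otimes> f')"
      unfolding eq using c c' by (simp add: m_assoc)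
    finally have "x [^] k \<otimes> e = ?d \<otimes> (y [^] j \<otimes> f')" .
    moreover have "?d \<in> D" using c d by (intro D_mult comm_in_D D_conj) auto
    moreover have "y [^] j \<otimes> f' \<in> power_products (y # xs)" using f' by auto
    ultimately show ?thesis by blast
  qed
qed simp

lemma D_mult_power_products:
  assumes xs: "set xs \<subseteq> carrier G" and g: "g \<in> generate G (set xs)"
  shows "\<exists>d\<in>D. \<exists>e\<in>power_products xs. g = d \<otimes> e"
proof -
  have "\<forall>e\<in>power_products xs. \<exists>d\<in>D. \<exists>e'\<in>power_products xs. g \<otimes> e = d \<otimes> e'"
    using g
  proof induction
    case one
    then show ?case using power_products_closed[OF xs] D_one by blast
  next
    case (incl x)
    then have "x [^] (1::int) = x" using xs by (auto simp: subset_iff)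
    then show ?case using power_products_absorb[OF xs incl, of _ 1] by simp
  next
    case (inv x)
    then have "x [^] (-1::int) = inv x" using xs by (auto simp: subset_iff int_pow_neg)
    then show ?case using power_products_absorb[OF xs inv, of _ "-1"] by simp
  next
    case (eng g h)
    have c: "g \<in> carrier G" "h \<in> carrier G" using eng.hyps generate_in_carrier[OF xs] by auto
    show ?case
    proof
      fix e assume e: "e \<in> power_products xs"
      obtain d e1 where 1: "d \<in> D" "e1 \<in> power_products xs" "h \<otimes> e = d \<otimes> e1"
        using eng.IH(2) e by blast
      obtain d' e2 where 2: "d' \<in> D" "e2 \<in> power_products xs" "g \<otimes> e1 = d' \<otimes> e2"
        using eng.IH(1) 1(2) by blast
      have c': "e \<in> carrier G" "d \<in> carrier G" "e1 \<in> carrier G" "d' \<in> carrier G" "e2 \<in> carrier G"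
        using power_products_closed[OF xs] e 1 2 D_subset by auto
      have "g \<otimes> h \<otimes> e = g \<otimes> (d \<otimes> e1)" using c c' 1(3) by (simp add: m_assoc)
      also have "\<dots> = (g \<otimes> d \<otimes> inv g) \<otimes> (g \<otimes> e1)" using c c' by (simp add: m_assoc)
      also have "\<dots> = (g \<otimes> d \<otimes> inv g \<otimes> d') \<otimes> e2" unfolding 2(3) using c c' by (simp add: m_assoc)
      finally show "\<exists>d\<in>D. \<exists>e'\<in>power_products xs. g \<otimes> h \<otimes> e = d \<otimes> e'"
        using c 1 2 by (metis D_mult D_conj)
    qed
  qed
  moreover have "g \<otimes> \<one> = g" using generate_in_carrier[OF xs g] by simp
  ultimately show ?thesis using one_in_power_products[of xs] by metis
qed

section \<open>Products of commutators with the generators\<close>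

text \<open>The factors stand in reverse order, so that the commutator with the first generator comes
  last; there it meets the first factor of \<^const>\<open>power_products\<close>.\<close>

fun comm_products :: "'a list \<Rightarrow> 'a set" where
  "comm_products [] = {\<one>}"
| "comm_products (x # xs) = {t \<otimes> comm g x | t g. t \<in> comm_products xs \<and> g \<in> carrier G}"

lemma comm_products_subset_D: "set xs \<subseteq> carrier G \<Longrightarrow> comm_products xs \<subseteq> D"
  by (induction xs) (auto intro: D_one D_mult comm_in_D)

lemma one_in_comm_products: "set xs \<subseteq> carrier G \<Longrightarrow> \<one> \<in> comm_products xs"
proof (induction xs)
  case (Cons x xs)
  then have "\<one> \<otimes> comm \<one> x \<in> comm_products (x # xs)"
    unfolding comm_products.simps by (intro CollectI exI[of _ \<one>] conjI refl) auto
  then show ?case using Cons.prems by simp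
qed simp

end

locale metabelian_group = group +
  assumes D_commute: "a \<in> D \<Longrightarrow> b \<in> D \<Longrightarrow> a \<otimes> b = b \<otimes> a"
begin

text \<open>As \<open>D\<close> is commutative, the factor belonging to \<open>x\<close> can be moved to the end and then varied
  freely. All later arguments modify a product of commutators through this lemma only, one
  generator at a time.\<close>

lemma comm_products_split:
  assumes "set xs \<subseteq> carrier G" "x \<in> set xs" "t \<in> comm_products xs"
  shows "\<exists>s\<in>D. \<exists>h\<in>carrier G. t = s \<otimes> comm h x \<and>
    (\<forall>h'\<in>carrier G. s \<otimes> comm h' x \<in> comm_products xs)"
  using assms
proof (induction xs arbitrary: t)
  case (Cons y xs)
  obtain u g where t: "t = u \<otimes> comm g y" and u: "u \<in> comm_products xs" and g: "g \<in> carrier G"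
    using Cons.prems(3) by auto
  have uD: "u \<in> D" using comm_products_subset_D[of xs] Cons.prems u by auto
  have y: "y \<in> carrier G" and x: "x \<in> carrier G" using Cons.prems by auto
  show ?case
  proof (cases "x = y")
    case True
    then show ?thesis using t u g uD by auto
  next
    case False
    then obtain s h where s: "s \<in> D" "h \<in> carrier G" "u = s \<otimes> comm h x"
      and all: "\<And>h'. h' \<in> carrier G \<Longrightarrow> s \<otimes> comm h' x \<in> comm_products xs"
      using Cons.IH[OF _ _ u] Cons.prems by auto
    have swap: "s \<otimes> comm g y \<otimes> comm h' x = s \<otimes> comm h' x \<otimes> comm g y"
      if h': "h' \<in> carrier G" for h'
    proof -
      have "comm g y \<otimes> comm h' x = comm h' x \<otimes> comm g y"
        using x y g h' by (intro D_commute comm_in_D)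
      then show ?thesis using x y g h' D_subset[OF s(1)]
        by (simp only: m_assoc m_closed inv_closed)
    qed
    have "s \<otimes> comm g y \<in> D" using s(1) g y by (intro D_mult comm_in_D)
    moreover have "t = s \<otimes> comm g y \<otimes> comm h x" by (simp only: t s(3) swap[OF s(2)])
    moreover have "s \<otimes> comm g y \<otimes> comm h' x \<in> comm_products (y # xs)"
      if "h' \<in> carrier G" for h'
      unfolding swap[OF that] using all[OF that] g by auto
    ultimately show ?thesis using s(2) by blast
  qed
qed simp

text \<open>In the module \<open>D\<close>, written additively, \<open>comm a g\<close> is \<open>a - g a\<close>. For a generator \<open>x\<close>,
  replacing the factor \<open>comm h x\<close> by \<open>comm (a \<otimes> h) x\<close> adds exactly \<open>a - x a\<close>. Induction on \<open>g\<close> uses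
  \<open>a - g h a = (a - h a) + (h a - g (h a))\<close> and, for inverses, \<open>a - inv x a = b - x b\<close> with
  \<open>b = - inv x a\<close>.\<close>

lemma comm_products_absorb_D:
  assumes xs: "set xs \<subseteq> carrier G" and g: "g \<in> generate G (set xs)"
    and "a \<in> D" "t \<in> comm_products xs"
  shows "t \<otimes> comm a g \<in> comm_products xs"
proof -
  have tc: "t \<in> carrier G" if "t \<in> comm_products xs" for t
    using that comm_products_subset_D[OF xs] D_subset by auto
  have gen: "t \<otimes> comm a x \<in> comm_products xs"
    if x: "x \<in> set xs" and a: "a \<in> D" and t: "t \<in> comm_products xs" for x a t
  proof -
    obtain s h where s: "s \<in> D" "h \<in> carrier G" "t = s \<otimes> comm h x"
      and all: "\<And>h'. h' \<in> carrier G \<Longrightarrow> s \<otimes> comm h' x \<in> comm_products xs"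
      using comm_products_split[OF xs x t] by auto
    have c: "x \<in> carrier G" "a \<in> carrier G" "s \<in> carrier G" using x xs a s D_subset by auto
    have "t \<otimes> comm a x = s \<otimes> (comm h x \<otimes> a) \<otimes> (x \<otimes> inv a \<otimes> inv x)"
      unfolding s(3) using c s(2) by (simp add: m_assoc)
    also have "comm h x \<otimes> a = a \<otimes> comm h x" using c s a by (intro D_commute comm_in_D)
    also have "s \<otimes> (a \<otimes> comm h x) \<otimes> (x \<otimes> inv a \<otimes> inv x) = s \<otimes> comm (a \<otimes> h) x"
      using c s(2) by (simp add: m_assoc inv_mult_group)
    finally show ?thesis using all c s(2) by simp
  qed
  have "\<forall>a\<in>D. \<forall>t\<in>comm_products xs. t \<otimes> comm a g \<in> comm_products xs"
    using g
  proof induction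
    case one
    then show ?case using tc D_subset by simp
  next
    case (incl x)
    then show ?case using gen by blast
  next
    case (inv x)
    show ?case
    proof (intro ballI)
      fix a t assume a: "a \<in> D" and t: "t \<in> comm_products xs"
      have c: "x \<in> carrier G" "a \<in> carrier G" using inv xs a D_subset by auto
      let ?b = "inv x \<otimes> inv a \<otimes> inv (inv x)"
      have b: "?b \<in> D" using a c by (intro D_conj D_inv) auto
      have "comm a (inv x) = a \<otimes> ?b" using c by (simp add: m_assoc)
      also have "\<dots> = ?b \<otimes> a" using a b by (intro D_commute)
      also have "\<dots> = comm ?b x" using c by (simp add: m_assoc inv_mult_group)
      finally show "t \<otimes> comm a (inv x) \<in> comm_products xs" using gen[OF inv b t] by simp
    qed
  next
    case (eng g h)
    show ?case
    proof (intro ballI)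
      fix a t assume a: "a \<in> D" and t: "t \<in> comm_products xs"
      have c: "g \<in> carrier G" "h \<in> carrier G" "a \<in> carrier G" "t \<in> carrier G"
        using eng.hyps generate_in_carrier[OF xs] a D_subset tc[OF t] by auto
      have "h \<otimes> a \<otimes> inv h \<in> D" using c a by (intro D_conj)
      moreover have "t \<otimes> comm a h \<in> comm_products xs" using eng.IH(2) a t by blast
      ultimately have "t \<otimes> comm a h \<otimes> comm (h \<otimes> a \<otimes> inv h) g \<in> comm_products xs"
        using eng.IH(1) by blast
      moreover have "t \<otimes> comm a h \<otimes> comm (h \<otimes> a \<otimes> inv h) g = t \<otimes> comm a (g \<otimes> h)"
        using c by (simp add: m_assoc inv_mult_group)
      ultimately show "t \<otimes> comm a (g \<otimes> h) \<in> comm_products xs" by simp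
    qed
  qed
  then show ?thesis using assms by blast
qed

text \<open>A conjugate \<open>u e u\<^sup>-\<^sup>1\<close> differs from \<open>e\<close> by \<open>comm (inv e) u\<close>, which is absorbed. This is the form
  in which the centrality of \<open>D\<close> modulo its commutators with \<open>G\<close> is used below.\<close>

lemma comm_products_absorb_conj:
  assumes xs: "set xs \<subseteq> carrier G" "generate G (set xs) = carrier G"
    and e: "e \<in> D" and u: "u \<in> carrier G" and t: "t \<in> carrier G"
    and te: "t \<otimes> e \<in> comm_products xs"
  shows "t \<otimes> (u \<otimes> e \<otimes> inv u) \<in> comm_products xs"
proof -
  have "t \<otimes> e \<otimes> comm (inv e) u \<in> comm_products xs"
    using xs u e by (intro comm_products_absorb_D te D_inv) auto
  moreover have "t \<otimes> e \<otimes> comm (inv e) u = t \<otimes> (u \<otimes> e \<otimes> inv u)"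
    using t u D_subset[OF e] by (simp add: m_assoc)
  ultimately show ?thesis by simp
qed

text \<open>Modulo the elements \<open>comm a g\<close> with \<open>a \<in> D\<close>, which are absorbed already, \<open>D\<close> is central and
  commutators are bilinear. Hence replacing the factor \<open>comm h x\<close> by \<open>comm (g \<otimes> h) x\<close> amounts to
  multiplying by \<open>comm g x\<close>, and bilinearity in the second argument passes from generators to all
  of \<open>G\<close>.\<close>

lemma comm_products_absorb_comm:
  assumes xs: "set xs \<subseteq> carrier G" "generate G (set xs) = carrier G"
    and "g \<in> carrier G" "h \<in> carrier G" "t \<in> comm_products xs"
  shows "t \<otimes> comm g h \<in> comm_products xs"
proof -
  have tc: "t \<in> carrier G" if "t \<in> comm_products xs" for t
    using that comm_products_subset_D[OF xs(1)] D_subset by auto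
  have gen: "t \<otimes> comm g x \<in> comm_products xs"
    if x: "x \<in> set xs" and g: "g \<in> carrier G" and t: "t \<in> comm_products xs" for x g t
  proof -
    obtain s h where s: "s \<in> D" "h \<in> carrier G" "t = s \<otimes> comm h x"
      and all: "\<And>h'. h' \<in> carrier G \<Longrightarrow> s \<otimes> comm h' x \<in> comm_products xs"
      using comm_products_split[OF xs(1) x t] by auto
    have c: "x \<in> carrier G" "s \<in> carrier G" using x xs s D_subset by auto
    let ?c = "comm h x"
    \<comment> \<open>The new factor is \<open>comm (g \<otimes> h) x\<close>, equal to \<open>comm g x\<close> times the \<open>g\<close>-conjugate of \<open>?c\<close>;
      the factor \<open>comm ?c g\<close> turns that conjugate back into \<open>?c\<close>.\<close>
    have cD: "?c \<in> D" "comm g x \<in> D" "g \<otimes> ?c \<otimes> inv g \<in> D"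
      using c g s(2) by (auto intro!: comm_in_D D_conj simp del: inv_mult_group)
    have cc: "?c \<in> carrier G" using D_subset[OF cD(1)] .
    have "s \<otimes> comm (g \<otimes> h) x \<otimes> comm ?c g \<in> comm_products xs"
      using xs g by (intro comm_products_absorb_D[OF xs(1) _ cD(1) all[OF m_closed[OF g s(2)]]]) simp
    moreover have "s \<otimes> comm (g \<otimes> h) x \<otimes> comm ?c g = t \<otimes> comm g x"
    proof -
      have "comm (g \<otimes> h) x = (g \<otimes> ?c \<otimes> inv g) \<otimes> comm g x"
        using c g s(2) by (simp add: m_assoc inv_mult_group)
      also have "\<dots> = comm g x \<otimes> (g \<otimes> ?c \<otimes> inv g)" using cD by (intro D_commute)
      finally have "comm (g \<otimes> h) x \<otimes> comm ?c g
          = comm g x \<otimes> ((g \<otimes> ?c \<otimes> inv g) \<otimes> ?c) \<otimes> (g \<otimes> inv ?c \<otimes> inv g)"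
        using c g s(2) cc by (simp add: m_assoc)
      also have "(g \<otimes> ?c \<otimes> inv g) \<otimes> ?c = ?c \<otimes> (g \<otimes> ?c \<otimes> inv g)" using cD by (intro D_commute)
      also have "comm g x \<otimes> (?c \<otimes> (g \<otimes> ?c \<otimes> inv g)) \<otimes> (g \<otimes> inv ?c \<otimes> inv g) = comm g x \<otimes> ?c"
        using c g s(2) by (simp add: m_assoc inv_mult_group)
      also have "\<dots> = ?c \<otimes> comm g x" using cD by (intro D_commute)
      finally show ?thesis unfolding s(3) using c g s(2) by (simp only: m_assoc m_closed inv_closed)
    qed
    ultimately show ?thesis by simp
  qed
  have "h \<in> generate G (set xs)" using assms by simp
  then have "\<forall>g\<in>carrier G. \<forall>t\<in>comm_products xs. t \<otimes> comm g h \<in> comm_products xs"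
  proof induction
    case one
    then show ?case using tc by simp
  next
    case (incl x)
    then show ?case using gen by blast
  next
    case (inv x)
    show ?case
    proof (intro ballI)
      fix g t assume g: "g \<in> carrier G" and t: "t \<in> comm_products xs"
      have x: "x \<in> carrier G" using inv xs by auto
      have "t \<otimes> ((inv x \<otimes> g) \<otimes> comm (inv g) x \<otimes> inv (inv x \<otimes> g)) \<in> comm_products xs"
        using x g gen[OF inv inv_closed[OF g] t]
        by (intro comm_products_absorb_conj[OF xs comm_in_D _ tc[OF t]]) auto
      moreover have "(inv x \<otimes> g) \<otimes> comm (inv g) x \<otimes> inv (inv x \<otimes> g) = comm g (inv x)"
        using x g by (simp add: m_assoc inv_mult_group)
      ultimately show "t \<otimes> comm g (inv x) \<in> comm_products xs" by simp
    qed
  next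
    case (eng h k)
    show ?case
    proof (intro ballI)
      fix g t assume g: "g \<in> carrier G" and t: "t \<in> comm_products xs"
      have c: "h \<in> carrier G" "k \<in> carrier G" "t \<in> carrier G"
        using eng.hyps generate_in_carrier[OF xs(1)] tc[OF t] by auto
      have "t \<otimes> comm g h \<otimes> comm g k \<in> comm_products xs" using eng.IH g t by blast
      then have "t \<otimes> comm g h \<otimes> (h \<otimes> comm g k \<otimes> inv h) \<in> comm_products xs"
        using c g by (intro comm_products_absorb_conj[OF xs comm_in_D]) simp_all
      moreover have "t \<otimes> comm g h \<otimes> (h \<otimes> comm g k \<otimes> inv h) = t \<otimes> comm g (h \<otimes> k)"
        using c g by (simp add: m_assoc inv_mult_group)
      ultimately show "t \<otimes> comm g (h \<otimes> k) \<in> comm_products xs" by simp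
    qed
  qed
  then show ?thesis using assms by blast
qed

lemma D_subset_comm_products:
  assumes xs: "set xs \<subseteq> carrier G" "generate G (set xs) = carrier G"
  shows "D \<subseteq> comm_products xs"
proof
  fix d assume d: "d \<in> D"
  have tc: "t \<in> carrier G" if "t \<in> comm_products xs" for t
    using that comm_products_subset_D[OF xs(1)] D_subset by auto
  have "d \<in> generate G (derived_set G (carrier G))" using d by (simp add: derived_def)
  then have "\<forall>t\<in>comm_products xs. t \<otimes> d \<in> comm_products xs"
  proof induction
    case one
    then show ?case using tc by simp
  next
    case (incl c)
    then show ?case using comm_products_absorb_comm[OF xs] by auto
  next
    case (inv c)
    then obtain g h where gh: "g \<in> carrier G" "h \<in> carrier G" "c = comm g h" by auto
    then have "inv c = comm h g" by (simp add: m_assoc inv_mult_group)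
    then show ?case using comm_products_absorb_comm[OF xs gh(2,1)] by simp
  next
    case (eng c d)
    then have "c \<in> carrier G" "d \<in> carrier G"
      using generate_in_carrier[OF derived_set_in_carrier[OF order_refl]] by auto
    then show ?case using eng.IH tc by (metis m_assoc)
  qed
  then have "\<one> \<otimes> d \<in> comm_products xs" using one_in_comm_products[OF xs(1)] by blast
  then show "d \<in> comm_products xs" using D_subset[OF d] by simp
qed

section \<open>The palindromic width\<close>

lemma carrier_palindrome_products:
  assumes xs: "set xs \<subseteq> carrier G" "generate G (set xs) = carrier G" and ne: "xs \<noteq> []"
    and g: "g \<in> carrier G"
  shows "g \<in> palindrome_products (set xs) (4 * length xs - 1)"
proof -
  let ?S = "set xs"
  have T: "comm_products ys \<subseteq> palindrome_products ?S (3 * length ys)" if "set ys \<subseteq> ?S" for ys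
    using that
  proof (induction ys)
    case (Cons y ys)
    show ?case
    proof
      fix t assume "t \<in> comm_products (y # ys)"
      then obtain u h where t: "t = u \<otimes> comm h y" "u \<in> comm_products ys" "h \<in> carrier G" by auto
      have "u \<otimes> comm h y \<in> palindrome_products ?S (3 * length ys + 3)"
        using Cons t(2,3) xs by (intro palindrome_products_mult comm_palindrome_products) auto
      then show "t \<in> palindrome_products ?S (3 * length (y # ys))" using t by (simp add: add.commute)
    qed
  qed (simp add: palindrome_products_0)
  have E: "power_products ys \<subseteq> palindrome_products ?S (length ys)" if "set ys \<subseteq> ?S" for ys
    using that
  proof (induction ys)
    case (Cons y ys)
    show ?case
    proof
      fix e assume "e \<in> power_products (y # ys)"
      then obtain k :: int and f where e: "e = y [^] k \<otimes> f" "f \<in> power_products ys" by auto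
      have "y [^] k \<otimes> f \<in> palindrome_products ?S (1 + length ys)"
        using Cons e(2) xs
        by (intro palindrome_products_mult palindrome_products_single int_pow_in_palindromes) auto
      then show "e \<in> palindrome_products ?S (length (y # ys))" using e by simp
    qed
  qed (simp add: palindrome_products_0)
  obtain x ys where ys: "xs = x # ys" using ne by (cases xs) auto
  obtain d e where d: "d \<in> D" and e: "e \<in> power_products xs" and g_eq: "g = d \<otimes> e"
    using D_mult_power_products[of xs g] xs g by auto
  obtain t h where t: "d = t \<otimes> comm h x" "t \<in> comm_products ys" "h \<in> carrier G"
    using D_subset_comm_products[OF xs] d by (auto simp: ys)
  obtain k :: int and f where f: "e = x [^] k \<otimes> f" "f \<in> power_products ys"
    using e by (auto simp: ys)
  have c: "x \<in> carrier G" "t \<in> carrier G" "f \<in> carrier G"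
    using xs(1) t(2) f(2) comm_products_subset_D[of ys] power_products_closed[of ys] D_subset
    by (auto simp: ys)
  have sub: "set ys \<subseteq> ?S" by (auto simp: ys)
  \<comment> \<open>Taking \<open>comm h x\<close> and \<open>x [^] k\<close> together costs three palindromes instead of four.\<close>
  have "t \<otimes> (comm h x \<otimes> x [^] k) \<otimes> f \<in> palindrome_products ?S (3 * length ys + 3 + length ys)"
    using T[OF sub] E[OF sub] t f xs
    by (intro palindrome_products_mult comm_mult_pow_palindrome_products) (auto simp: ys)
  moreover have "g = t \<otimes> (comm h x \<otimes> x [^] k) \<otimes> f"
    using c t(3) by (simp add: g_eq t(1) f(1) m_assoc)
  moreover have "3 * length ys + 3 + length ys = 4 * length xs - 1" by (simp add: ys)
  ultimately show ?thesis by simp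
qed

theorem palindromic_width_le:
  assumes S: "S \<subseteq> carrier G" "generate G S = carrier G" "finite S" "S \<noteq> {}"
  shows "palindromic_width G S \<le> enat (4 * card S - 1)"
  unfolding palindromic_width_def
proof (rule SUP_least)
  fix g assume g: "g \<in> carrier G"
  obtain xs where xs: "set xs = S" "length xs = card S"
    using finite_distinct_list[OF S(3)] distinct_card by metis
  have "g \<in> palindrome_products S (4 * card S - 1)"
    using carrier_palindrome_products[of xs g] xs S g by auto
  then obtain ps where "ps \<in> lists (palindromes G S)" "length ps = 4 * card S - 1"
    "foldr (\<otimes>) ps \<one> = g"
    by (auto simp: palindrome_products_def)
  then show "palindromic_length G S g \<le> enat (4 * card S - 1)"
    unfolding palindromic_length_def by (intro Inf_lower) (auto intro!: exI[of _ ps])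
qed

end

section \<open>The free metabelian group\<close>

lemma (in group) second_derived_normal: "second_derived G \<lhd> G"
  unfolding second_derived_def by (intro derived_is_normal derived_self_is_normal)

lemma (in group) group_hom_max_metabelian_quotient:
  "group_hom G (max_metabelian_quotient G) (\<lambda>a. second_derived G #> a)"
proof -
  interpret N: normal "second_derived G" G by (rule second_derived_normal)
  show ?thesis
    using N.factorgroup_is_group N.r_coset_hom_Mod
    by (simp add: group_hom_def group_hom_axioms_def is_group max_metabelian_quotient_def)
qed

text \<open>The derived subgroup of the quotient is the image of \<open>D\<close>, and commutators of elements of \<open>D\<close>
  lie in the kernel.\<close>

lemma (in group) metabelian_max_metabelian_quotient:
  "metabelian_group (max_metabelian_quotient G)"
proof -
  let ?Q = "max_metabelian_quotient G" and ?N = "second_derived G"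
  interpret N: normal ?N G by (rule second_derived_normal)
  interpret h: group_hom G ?Q "\<lambda>a. ?N #> a" by (rule group_hom_max_metabelian_quotient)
  have carr: "carrier ?Q = (\<lambda>a. ?N #> a) ` carrier G"
    by (auto simp: max_metabelian_quotient_def FactGroup_def RCOSETS_def)
  show ?thesis
  proof
    fix a b assume "a \<in> derived ?Q (carrier ?Q)" "b \<in> derived ?Q (carrier ?Q)"
    then obtain u v where uv: "u \<in> D" "v \<in> D" "a = ?N #> u" "b = ?N #> v"
      unfolding carr h.derived_img[OF order_refl] by auto
    have c: "u \<in> carrier G" "v \<in> carrier G" using uv D_subset by auto
    have "comm u v \<in> ?N"
      unfolding second_derived_def derived_def[of G D] using uv by (intro generate.incl) auto
    then have "?N #> (comm u v) = ?N" using N.rcos_const by simp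
    then have "\<one>\<^bsub>?Q\<^esub> = ?N #> (comm u v)"
      by (simp add: max_metabelian_quotient_def FactGroup_def)
    moreover have "u \<otimes> v = comm u v \<otimes> (v \<otimes> u)" using c by (simp add: m_assoc)
    ultimately have "?N #> (u \<otimes> v) = \<one>\<^bsub>?Q\<^esub> \<otimes>\<^bsub>?Q\<^esub> (?N #> (v \<otimes> u))"
      using h.hom_mult[of "comm u v" "v \<otimes> u"] c by (metis inv_closed m_closed)
    also have "\<dots> = ?N #> (v \<otimes> u)"
      using c by (intro h.H.l_one h.hom_closed m_closed)
    finally have "?N #> (u \<otimes> v) = ?N #> (v \<otimes> u)" .
    then show "a \<otimes>\<^bsub>?Q\<^esub> b = b \<otimes>\<^bsub>?Q\<^esub> a" using uv c by simp
  qed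
qed

lemma (in group) generate_basis_image:
  assumes "free_basis G B"
  shows "generate (max_metabelian_quotient G) (basis_image G B) = carrier (max_metabelian_quotient G)"
proof -
  let ?Q = "max_metabelian_quotient G" and ?N = "second_derived G"
  interpret h: group_hom G ?Q "\<lambda>a. ?N #> a" by (rule group_hom_max_metabelian_quotient)
  have B: "B \<subseteq> carrier G" and iso: "word_value G ` reduced_words B = carrier G"
    using assms by (auto simp: free_basis_def iso_def bij_betw_def free_group_def)
  have "carrier G \<subseteq> generate G B"
    unfolding iso[symmetric] by (auto simp: reduced_words_def intro!: word_value_in_generate)
  then have "generate G B = carrier G" using generate_incl[OF B] by auto
  then show ?thesis
    using h.generate_img[OF B]
    by (auto simp: basis_image_def max_metabelian_quotient_def FactGroup_def RCOSETS_def)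
qed

theorem theorem1p3:
  fixes F :: "('g, 'm) monoid_scheme" and B :: "'g set" and n :: nat
  assumes "group F" and "free_basis F B" and "card B = n" and "n \<ge> 1"
  shows "palindromic_width (max_metabelian_quotient F) (basis_image F B) \<le> enat (4 * n - 1)"
proof -
  let ?Q = "max_metabelian_quotient F" and ?X = "basis_image F B"
  interpret F: group F by fact
  interpret Q: metabelian_group ?Q by (rule F.metabelian_max_metabelian_quotient)
  have B: "finite B" "B \<noteq> {}" "B \<subseteq> carrier F"
    using assms by (auto simp: free_basis_def card_ge_0_finite)
  have X: "?X \<subseteq> carrier ?Q" "finite ?X" "?X \<noteq> {}" "card ?X \<le> n"
    using B assms(3) card_image_le[of B]
    by (auto simp: basis_image_def max_metabelian_quotient_def FactGroup_def RCOSETS_def)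
  \<comment> \<open>The bound is monotone in the number of generators, so \<open>card ?X \<le> n\<close> suffices.\<close>
  have "palindromic_width ?Q ?X \<le> enat (4 * card ?X - 1)"
    using X F.generate_basis_image[OF assms(2)] by (intro Q.palindromic_width_le)
  also have "\<dots> \<le> enat (4 * n - 1)" using X(4) by (simp add: diff_le_mono)
  finally show ?thesis .
qed

end
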